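(* Suppose that $S \neq \emptyset$ and $Q$ is positive semidefinite on the null space of $A$, i.e., $d^TQd \ge 0$ for all $d \in \mathbb{R}^n$ with $Ad = 0$. Then, for any $\mathcal{K} \in \mathbb{K}$, \[ \ell_{\mathcal{K}}(x) = q(x), \quad x \in S. \] Therefore, the convex relaxation $(P(\mathcal{K}))$ is exact, i.e., $\ell_{\mathcal{K}} = \ell^*$. Furthermore, for any optimal solution $Y^* \in \mathcal{S}^{n+1}$ of $(P(\mathcal{K}))$, the vector $x^* = (Y^*_{01},\ldots,Y^*_{0n})^T$ is an optimal solution of $(QP)$.
   Context: Quadratic program: let $Q \in \mathbb{R}^{n\times n}$ be symmetric, $c \in \mathbb{R}^n$, $A \in \mathbb{R}^{m \times n}$, $b \in \mathbb{R}^m$; put $q(x) = x^T Q x + 2c^T x$ and $S = \{x \in \mathbb{R}^n : Ax = b,\ x \ge 0\}$. $(QP)$ is the problem of minimizing $q(x)$ over $x \in S$, with optimal value (infimum) $\ell^* \in \mathbb{R}\cup\{-\infty,+\infty\}$. $\mathcal{S}^N$ denotes the real symmetric $N\times N$ matrices, and $\langle U,V\rangle = \sum_{i,j} U_{ij}V_{ij}$. Rows and columns of matrices in $\mathcal{S}^{n+1}$ are indexed by $0,1,\ldots,n$. $\mathcal{CP}^N = \{\sum_{j=1}^k y^j (y^j)^T : k \ge 1,\ y^j \in \mathbb{R}^N_+\}$ is the cone of completely positive matrices, and $\mathcal{P}^{n+1}$ is the cone of positive semidefinite $Y \in \mathcal{S}^{n+1}$ with $Y_{0j} \ge 0$ for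 $j = 1,\ldots,n$. $\mathbb{K}$ is the family of all closed convex cones $\mathcal{K} \subseteq \mathcal{S}^{n+1}$ with $\mathcal{CP}^{n+1} \subseteq \mathcal{K} \subseteq \mathcal{P}^{n+1}$. Let \[ \widehat{Q} = \begin{bmatrix} 0 & c^T \\ c & Q\end{bmatrix}, \qquad \widehat{A} = \begin{bmatrix} b^Tb & -b^TA \\ -A^Tb & A^TA\end{bmatrix}. \] $(P(\mathcal{K}))$: minimize $\langle \widehat{Q}, Y\rangle$ subject to $\langle \widehat{A}, Y\rangle = 0$, $Y_{00} = 1$, $Y \in \mathcal{K}$; its optimal value (infimum, possibly $-\infty$) is $\ell_{\mathcal{K}}$. For $\tilde{x} \in S$, $(P(\mathcal{K},\tilde{x}))$ is the same problem with the additional constraint that $(Y_{01},\ldots,Y_{0n}) = \tilde{x}^T$; its optimal value (infimum) is $\ell_{\mathcal{K}}(\tilde{x})$. *)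

theory Defs
  imports "HOL-Analysis.Analysis"
begin

text \<open>
  Vectors in \<open>\<real>\<^sup>n\<close> have type \<open>real^'n\<close>. Matrices of order \<open>n + 1\<close>, whose rows and columns are
  numbered \<open>0, 1, \<dots>, n\<close>, are indexed by \<open>'n option\<close>: \<open>None\<close> is the index \<open>0\<close>, and \<open>Some j\<close>
  is the index \<open>j\<close> in \<open>1, \<dots>, n\<close>. The inner product \<open>\<langle>U, V\<rangle> = \<Sum>\<^sub>i\<^sub>j U\<^sub>i\<^sub>j V\<^sub>i\<^sub>j\<close> is the library's
  \<open>U \<bullet> V\<close>, and all optimal values are infima in \<open>ereal\<close> (so the infimum over an empty
  feasible set is \<open>\<infinity>\<close>).
\<close>

section \<open>The quadratic program\<close>

definition qp_obj :: "real^'n^'n \<Rightarrow> real^'n \<Rightarrow> real^'n \<Rightarrow> real" where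
  "qp_obj Q c x = x \<bullet> (Q *v x) + 2 * (c \<bullet> x)"

definition qp_feas :: "real^'n^'m \<Rightarrow> real^'m \<Rightarrow> (real^'n) set" where
  "qp_feas A b = {x. A *v x = b \<and> (\<forall>j. 0 \<le> x $ j)}"

definition qp_val :: "real^'n^'n \<Rightarrow> real^'n \<Rightarrow> real^'n^'m \<Rightarrow> real^'m \<Rightarrow> ereal" where
  "qp_val Q c A b = (INF x\<in>qp_feas A b. ereal (qp_obj Q c x))"

definition qp_optimal ::
    "real^'n^'n \<Rightarrow> real^'n \<Rightarrow> real^'n^'m \<Rightarrow> real^'m \<Rightarrow> real^'n \<Rightarrow> bool" where
  "qp_optimal Q c A b x \<longleftrightarrow> is_arg_min (qp_obj Q c) (\<lambda>x. x \<in> qp_feas A b) x"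

section \<open>Matrix cones\<close>

definition sym_mats :: "(real^'k^'k) set" where
  "sym_mats = {Y. transpose Y = Y}"

definition outer :: "real^'k \<Rightarrow> real^'k^'k" where
  "outer y = (\<chi> i j. y $ i * y $ j)"

definition CP :: "(real^'k^'k) set" where
  "CP = {\<Sum>j=1..k. outer (y j) | (k::nat) (y :: nat \<Rightarrow> real^'k).
           k \<ge> 1 \<and> (\<forall>j\<in>{1..k}. \<forall>i. 0 \<le> y j $ i)}"

definition psd :: "real^'k^'k \<Rightarrow> bool" where
  "psd Y \<longleftrightarrow> (\<forall>z. 0 \<le> z \<bullet> (Y *v z))"

definition PSD0 :: "(real^('n::finite option)^('n option)) set" where
  "PSD0 = {Y \<in> sym_mats. psd Y \<and> (\<forall>j. 0 \<le> Y $ None $ Some j)}"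

text \<open>
  The family \<open>\<bbbK>\<close>. The inclusion in \<open>PSD0\<close> makes every member a set of symmetric matrices;
  since the symmetric matrices form a closed subspace, closedness in the full matrix space
  agrees with closedness relative to it.
\<close>

definition cone_family :: "(real^('n::finite option)^('n option)) set set" where
  "cone_family = {K. closed K \<and> convex K \<and> cone K \<and> CP \<subseteq> K \<and> K \<subseteq> PSD0}"

section \<open>The convex relaxation\<close>

definition Qhat :: "real^'n^'n \<Rightarrow> real^'n \<Rightarrow> real^('n::finite option)^('n option)" where
  "Qhat Q c = (\<chi> i j. case (i, j) of
      (None, None) \<Rightarrow> 0
    | (None, Some l) \<Rightarrow> c $ l
    | (Some k, None) \<Rightarrow> c $ k
    | (Some k, Some l) \<Rightarrow> Q $ k $ l)"

definition Ahat :: "real^'n^'m \<Rightarrow> real^'m \<Rightarrow> real^('n::finite option)^('n option)" where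
  "Ahat A b = (\<chi> i j. case (i, j) of
      (None, None) \<Rightarrow> b \<bullet> b
    | (None, Some l) \<Rightarrow> - ((b v* A) $ l)
    | (Some k, None) \<Rightarrow> - ((transpose A *v b) $ k)
    | (Some k, Some l) \<Rightarrow> (transpose A ** A) $ k $ l)"

definition row0 :: "real^('n::finite option)^('n option) \<Rightarrow> real^'n" where
  "row0 Y = (\<chi> j. Y $ None $ Some j)"

definition rel_feas :: "real^'n^'m \<Rightarrow> real^'m \<Rightarrow> (real^('n::finite option)^('n option)) set
    \<Rightarrow> (real^('n::finite option)^('n option)) set" where
  "rel_feas A b K = {Y \<in> K. Ahat A b \<bullet> Y = 0 \<and> Y $ None $ None = 1}"

definition rel_val :: "real^'n^'n \<Rightarrow> real^'n \<Rightarrow> real^'n^'m \<Rightarrow> real^'m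
    \<Rightarrow> (real^('n::finite option)^('n option)) set \<Rightarrow> ereal" where
  "rel_val Q c A b K = (INF Y\<in>rel_feas A b K. ereal (Qhat Q c \<bullet> Y))"

definition rel_val_at :: "real^'n^'n \<Rightarrow> real^'n \<Rightarrow> real^'n^'m \<Rightarrow> real^'m
    \<Rightarrow> (real^('n::finite option)^('n option)) set \<Rightarrow> real^'n \<Rightarrow> ereal" where
  "rel_val_at Q c A b K x = (INF Y\<in>{Y \<in> rel_feas A b K. row0 Y = x}. ereal (Qhat Q c \<bullet> Y))"

definition rel_optimal :: "real^'n^'n \<Rightarrow> real^'n \<Rightarrow> real^'n^'m \<Rightarrow> real^'m
    \<Rightarrow> (real^('n::finite option)^('n option)) set \<Rightarrow> real^('n::finite option)^('n option) \<Rightarrow> bool" where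
  "rel_optimal Q c A b K Y \<longleftrightarrow> is_arg_min (\<lambda>Y. Qhat Q c \<bullet> Y) (\<lambda>Y. Y \<in> rel_feas A b K) Y"

end

theory Submission
  imports Defs
begin

text \<open>
  A feasible \<open>Y\<close> of the relaxation is positive semidefinite and is annihilated by the matrix
  \<open>[b, -A]\<close>. Subtracting from \<open>Y\<close> the outer product of its column \<open>0\<close>, which is \<open>(1, x)\<close> with
  \<open>x\<close> in \<open>S\<close>, leaves a positive semidefinite matrix whose range consists of vectors \<open>(0, d)\<close>
  with \<open>A d = 0\<close>. By splitting off further rank-one matrices in the same way (so that no spectral
  theorem is needed), its inner product with the matrix of the objective is seen to be
  nonnegative, and hence the objective at \<open>Y\<close> is at least \<open>q(x)\<close>.
\<close>

section \<open>Positive semidefinite matrices and rank-one deflation\<close>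

lemma sym_mats_inner_commute:
  assumes "Y \<in> sym_mats"
  shows "x \<bullet> (Y *v y) = y \<bullet> (Y *v x)"
  using assms dot_lmul_matrix[of x Y y]
  by (simp add: sym_mats_def inner_commute flip: transpose_matrix_vector)

lemma outer_mult_vector: "outer y *v z = (y \<bullet> z) *\<^sub>R y"
  by (simp add: vec_eq_iff outer_def matrix_vector_mult_def inner_vec_def sum_distrib_left
      algebra_simps)

lemma inner_outer: "M \<bullet> outer y = y \<bullet> (M *v y)"
  by (simp add: inner_vec_def outer_def matrix_vector_mult_def sum_distrib_left algebra_simps)

lemma matrix_diagonal_entry: "axis k 1 \<bullet> (Y *v axis k 1) = (Y::real^'k^'k) $ k $ k"
  by (simp add: matrix_vector_mult_basis column_def inner_axis_axis inner_axis')

text \<open>If \<open>w = Y *v z\<close> were nonzero, then moving from \<open>z\<close> a short way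
  along \<open>- w\<close> would make the quadratic form negative: its first-order term is
  \<open>- 2 * t * (w \<bullet> w)\<close>.\<close>

lemma psd_kernel:
  assumes "Y \<in> sym_mats" "psd Y" "z \<bullet> (Y *v z) = 0"
  shows "Y *v z = 0"
proof (rule ccontr)
  assume "Y *v z \<noteq> 0"
  define w where "w = Y *v z"
  define a where "a = w \<bullet> w"
  define e where "e = w \<bullet> (Y *v w)"
  \<comment> \<open>Small enough that \<open>t * e \<le> a\<close>; the added 1 keeps
    \<open>t\<close> meaningful when \<open>e = 0\<close>.\<close>
  define t where "t = a / (e + 1)"
  have a: "a > 0" using \<open>Y *v z \<noteq> 0\<close> by (simp add: a_def w_def)
  have e: "e \<ge> 0" using assms(2) by (simp add: e_def psd_def)
  have zw: "z \<bullet> (Y *v w) = a"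
    using sym_mats_inner_commute[OF assms(1), of z w] by (simp add: a_def w_def)
  have "0 \<le> (z - t *\<^sub>R w) \<bullet> (Y *v (z - t *\<^sub>R w))"
    using assms(2) unfolding psd_def by blast
  also have "\<dots> = t * (t * e - 2 * a)"
    using assms(3) zw
    by (simp add: matrix_vector_mult_diff_distrib matrix_vector_mult_scaleR inner_diff_left
        inner_diff_right flip: w_def) (simp add: a_def e_def algebra_simps)
  finally have "0 \<le> t * (t * e - 2 * a)" .
  moreover have "t > 0"
    using a e by (simp add: t_def)
  ultimately have "0 \<le> t * e - 2 * a"
    by (simp add: zero_le_mult_iff)
  moreover have "t * e \<le> a"
    using a e by (simp add: t_def field_simps)
  ultimately show False using a by simp
qed

text \<open>One step of symmetric Gaussian elimination: for symmetric \<open>Y\<close> with nonzero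
  pivot \<open>Y $ k $ k\<close> it clears row and column \<open>k\<close>, leaving the Schur
  complement in the other entries.\<close>

definition deflate :: "real^'k^'k \<Rightarrow> 'k \<Rightarrow> real^'k^'k" where
  "deflate Y k = Y - (1 / Y $ k $ k) *\<^sub>R outer (Y *v axis k 1)"

text \<open>In this form the range of the deflated matrix visibly lies in the range of
  \<open>Y\<close>, so conditions on the range survive deflation.\<close>

lemma deflate_mult_vector:
  fixes Y :: "real^'k^'k"
  shows "deflate Y k *v z = Y *v (z - (((Y *v axis k 1) \<bullet> z) / Y $ k $ k) *\<^sub>R axis k 1)"
  by (simp add: deflate_def matrix_vector_mult_diff_distrib matrix_vector_mult_diff_rdistrib
      matrix_vector_mult_scaleR scaleR_matrix_vector_assoc[symmetric] outer_mult_vector)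

lemma deflate_sym:
  assumes "Y \<in> sym_mats"
  shows "deflate Y k \<in> sym_mats"
  using assms by (simp add: sym_mats_def deflate_def outer_def transpose_def vec_eq_iff mult.commute)

lemma deflate_psd:
  assumes "Y \<in> sym_mats" "psd Y" "Y $ k $ k \<noteq> 0"
  shows "psd (deflate Y k)"
  unfolding psd_def
proof
  fix z
  define u where "u = Y *v axis k 1"
  define s where "s = (u \<bullet> z) / Y $ k $ k"
  \<comment> \<open>\<open>w\<close> is \<open>z\<close> shifted along \<open>axis k 1\<close> until
    it is \<open>Y\<close>-orthogonal to that axis; the deflated form at \<open>z\<close> is then
    the form of \<open>Y\<close> at \<open>w\<close>.\<close>
  define w where "w = z - s *\<^sub>R axis k 1"
  have "axis k 1 \<bullet> (Y *v z) = u \<bullet> z"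
    using sym_mats_inner_commute[OF assms(1), of "axis k 1" z] by (simp add: u_def inner_commute)
  then have "axis k 1 \<bullet> (Y *v w) = 0"
    using assms(3) unfolding w_def
    by (simp add: matrix_vector_mult_diff_distrib matrix_vector_mult_scaleR inner_diff_right
        matrix_diagonal_entry s_def)
  then have "z \<bullet> (Y *v w) = w \<bullet> (Y *v w)"
    by (subst (2) w_def) (simp add: inner_diff_left)
  then show "0 \<le> z \<bullet> (deflate Y k *v z)"
    using assms(2) by (simp add: deflate_mult_vector psd_def flip: u_def s_def w_def)
qed

lemma deflate_axis:
  assumes "Y $ k $ k \<noteq> 0"
  shows "deflate Y k *v axis k 1 = 0"
  using assms matrix_diagonal_entry[of k Y] by (simp add: deflate_mult_vector inner_commute)

lemma deflate_axis_eq_0: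
  assumes "Y \<in> sym_mats" "Y *v axis i 1 = 0"
  shows "deflate Y k *v axis i 1 = 0"
proof -
  have "(Y *v axis k 1) \<bullet> axis i 1 = 0"
    using sym_mats_inner_commute[OF assms(1), of "axis i 1" "axis k 1"] assms(2)
    by (simp add: inner_commute)
  then show ?thesis using assms(2) by (simp add: deflate_mult_vector)
qed

text \<open>Each deflation splits off a positive multiple of \<open>outer u\<close> with
  \<open>u\<close> in the range of \<open>Y\<close>, where \<open>M\<close> is nonnegative. Zero
  columns stay zero and column \<open>k\<close> becomes zero, so the number of nonzero columns
  decreases.\<close>

lemma inner_psd_nonneg:
  fixes M Y :: "real^'k^'k"
  assumes "Y \<in> sym_mats" "psd Y" "\<And>z. 0 \<le> (Y *v z) \<bullet> (M *v (Y *v z))"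
  shows "0 \<le> M \<bullet> Y"
  using assms
proof (induction "card {i. Y *v axis i 1 \<noteq> 0}" arbitrary: Y rule: less_induct)
  case less
  show ?case
  proof (cases "\<forall>i. Y *v axis i 1 = 0")
    case True
    then have "Y = 0"
      by (simp add: matrix_vector_mult_basis column_def vec_eq_iff)
    then show ?thesis by simp
  next
    case False
    then obtain k where k: "Y *v axis k 1 \<noteq> 0" by blast
    \<comment> \<open>A zero diagonal entry would put \<open>axis k 1\<close> into the kernel, by
      \<open>psd_kernel\<close>.\<close>
    have "Y $ k $ k \<noteq> 0"
      using k psd_kernel[OF less.prems(1,2)] matrix_diagonal_entry[of k Y] by metis
    moreover have "Y $ k $ k \<ge> 0"
      using less.prems(2) matrix_diagonal_entry[of k Y] by (metis psd_def)
    ultimately have pos: "Y $ k $ k > 0" by simp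
    have "{i. deflate Y k *v axis i 1 \<noteq> 0} \<subset> {i. Y *v axis i 1 \<noteq> 0}"
      using k pos deflate_axis[of Y k] deflate_axis_eq_0[OF less.prems(1)] by fastforce
    then have "card {i. deflate Y k *v axis i 1 \<noteq> 0} < card {i. Y *v axis i 1 \<noteq> 0}"
      by (simp add: psubset_card_mono)
    then have "0 \<le> M \<bullet> deflate Y k"
      using less.hyps deflate_sym deflate_psd less.prems pos
      by (metis deflate_mult_vector less_irrefl)
    moreover have "M \<bullet> Y = M \<bullet> deflate Y k
        + (1 / Y $ k $ k) * ((Y *v axis k 1) \<bullet> (M *v (Y *v axis k 1)))"
      by (simp add: deflate_def inner_diff_right inner_outer)
    moreover have "0 \<le> (1 / Y $ k $ k) * ((Y *v axis k 1) \<bullet> (M *v (Y *v axis k 1)))"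
      using pos less.prems(3) by simp
    ultimately show ?thesis by linarith
  qed
qed

section \<open>Block vectors and the rows of the homogenized constraints\<close>

lemma sum_option: "(\<Sum>i\<in>UNIV. f i) = f None + (\<Sum>j\<in>UNIV. f (Some (j::'n::finite)))"
  by (simp add: UNIV_option_conv sum.reindex)

definition homog :: "real \<Rightarrow> real^'n \<Rightarrow> real^('n::finite option)" where
  "homog t x = (\<chi> i. case i of None \<Rightarrow> t | Some j \<Rightarrow> x $ j)"

lemma homog_exhaust:
  obtains t x where "z = homog t x"
proof
  show "z = homog (z $ None) (\<chi> j. z $ Some j)"
    by (simp add: homog_def vec_eq_iff split: option.split)
qed

lemma homog_None [simp]: "homog t x $ None = t"
  by (simp add: homog_def)

lemma homog_Some [simp]: "homog t x $ Some j = x $ j"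
  by (simp add: homog_def)

lemma homog_Qhat: "homog t x \<bullet> (Qhat Q c *v homog t x) = x \<bullet> (Q *v x) + 2 * t * (c \<bullet> x)"
  by (simp add: inner_vec_def matrix_vector_mult_def sum_option Qhat_def algebra_simps
      sum.distrib sum_distrib_left)

text \<open>Row \<open>i\<close> of the block matrix \<open>[b, -A]\<close>, of which
  \<open>Ahat\<close> is the Gram matrix.\<close>

definition constraint_row :: "real^'n^'m \<Rightarrow> real^'m \<Rightarrow> 'm \<Rightarrow> real^('n::finite option)" where
  "constraint_row A b i = homog (b $ i) (- (A $ i))"

lemma constraint_row_inner: "constraint_row A b i \<bullet> homog t x = t * b $ i - (A *v x) $ i"
  by (simp add: constraint_row_def inner_vec_def sum_option matrix_vector_mult_def
      sum_negf mult.commute)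

lemma Ahat_eq_sum_outer: "Ahat A b = (\<Sum>i\<in>UNIV. outer (constraint_row A b i))"
  by (simp add: vec_eq_iff Ahat_def constraint_row_def outer_def homog_def inner_vec_def
      vector_matrix_mult_def matrix_vector_mult_def matrix_matrix_mult_def transpose_def
      sum_negf mult.commute split: option.split)

lemma inner_Ahat:
  "Ahat A b \<bullet> Y = (\<Sum>i\<in>UNIV. constraint_row A b i \<bullet> (Y *v constraint_row A b i))"
  by (simp add: Ahat_eq_sum_outer inner_sum_left inner_commute[of "outer _"] inner_outer)

section \<open>Feasible matrices of the relaxation and the lower bound\<close>

lemma rel_feas_kernel:
  assumes "K \<subseteq> PSD0" "Y \<in> rel_feas A b K"
  shows "constraint_row A b i \<bullet> (Y *v z) = 0"
proof -
  have Y: "Y \<in> sym_mats" "psd Y"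
    using assms by (auto simp: rel_feas_def PSD0_def)
  let ?r = "constraint_row A b"
  \<comment> \<open>The single equation on \<open>Ahat\<close> says that nonnegative terms sum to
    zero, so each of them vanishes.\<close>
  have "(\<Sum>i\<in>UNIV. ?r i \<bullet> (Y *v ?r i)) = 0"
    using assms(2) by (simp add: rel_feas_def inner_Ahat)
  then have "?r i \<bullet> (Y *v ?r i) = 0"
    using Y(2) by (subst (asm) sum_nonneg_eq_0_iff) (auto simp: psd_def)
  then have "Y *v ?r i = 0" using psd_kernel Y by blast
  then show ?thesis
    using sym_mats_inner_commute[OF Y(1), of "?r i" z] by simp
qed

lemma rel_feas_column0:
  assumes "K \<subseteq> PSD0" "Y \<in> rel_feas A b K"
  shows "Y *v axis None 1 = homog 1 (row0 Y)"
proof -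
  have "transpose Y = Y" and Y00: "Y $ None $ None = 1"
    using assms by (auto simp: rel_feas_def PSD0_def sym_mats_def)
  then have column: "Y *v axis None 1 = Y $ None"
    by (metis column_transpose matrix_vector_mult_basis row_def vec_nth_inverse)
  show ?thesis
    unfolding column using Y00 by (simp add: vec_eq_iff homog_def row0_def split: option.split)
qed

lemma row0_feasible:
  assumes "K \<subseteq> PSD0" "Y \<in> rel_feas A b K"
  shows "row0 Y \<in> qp_feas A b"
proof -
  \<comment> \<open>Column 0 of \<open>Y\<close> is \<open>(1, row0 Y)\<close> and lies in the range
    of \<open>Y\<close>, which is orthogonal to every constraint row.\<close>
  have "b $ i - (A *v row0 Y) $ i = 0" for i
    using rel_feas_kernel[OF assms, of i "axis None 1"]
    by (simp add: rel_feas_column0[OF assms] constraint_row_inner)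
  moreover have "0 \<le> row0 Y $ j" for j
    using assms by (auto simp: rel_feas_def PSD0_def row0_def)
  ultimately show ?thesis by (simp add: qp_feas_def vec_eq_iff)
qed

lemma qp_obj_row0_le:
  assumes psdQ: "\<forall>d. A *v d = 0 \<longrightarrow> 0 \<le> d \<bullet> (Q *v d)"
    and K: "K \<subseteq> PSD0" and Y: "Y \<in> rel_feas A b K"
  shows "qp_obj Q c (row0 Y) \<le> Qhat Q c \<bullet> Y"
proof -
  have sym: "Y \<in> sym_mats" and psd: "psd Y" and Y00: "Y $ None $ None = 1"
    using K Y by (auto simp: rel_feas_def PSD0_def)
  let ?Z = "deflate Y None"
  have "0 \<le> (?Z *v z) \<bullet> (Qhat Q c *v (?Z *v z))" for z
  proof -
    obtain t d where d: "?Z *v z = homog t d" by (rule homog_exhaust)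
    \<comment> \<open>Deflation at the pivot \<open>Y $ None $ None = 1\<close> cleared row 0, so
      range vectors of \<open>?Z\<close> have head 0.\<close>
    have "axis None 1 \<bullet> (?Z *v z) = 0"
      using sym_mats_inner_commute[OF deflate_sym[OF sym], of "axis None 1" None z]
      by (simp add: deflate_axis Y00)
    then have "t = 0" by (simp add: d inner_axis')
    moreover have "t * b $ i - (A *v d) $ i = 0" for i
      using rel_feas_kernel[OF K Y, of i] by (metis constraint_row_inner d deflate_mult_vector)
    ultimately have "A *v d = 0" by (simp add: vec_eq_iff)
    then show ?thesis using psdQ \<open>t = 0\<close> by (simp add: d homog_Qhat)
  qed
  then have "0 \<le> Qhat Q c \<bullet> ?Z"
    using inner_psd_nonneg deflate_sym deflate_psd sym psd Y00 by (metis zero_neq_one)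
  \<comment> \<open>The part split off is \<open>outer (homog 1 (row0 Y))\<close>, whose pairing
    with \<open>Qhat Q c\<close> is the quadratic objective at \<open>row0 Y\<close>.\<close>
  then show ?thesis
    by (simp add: deflate_def Y00 rel_feas_column0[OF K Y] inner_diff_right inner_outer
        homog_Qhat qp_obj_def)
qed

section \<open>The rank-one lift and the equality of the optimal values\<close>

lemma outer_homog_feasible:
  assumes "CP \<subseteq> K" "x \<in> qp_feas A b"
  shows "outer (homog 1 x) \<in> rel_feas A b K"
proof -
  let ?y = "homog 1 x"
  have "0 \<le> ?y $ i" for i
    using assms(2) by (cases i) (simp_all add: qp_feas_def)
  then have "(\<Sum>j=1..1::nat. outer ((\<lambda>_. ?y) j)) \<in> CP"
    unfolding CP_def mem_Collect_eq by (intro exI[of _ 1] exI[of _ "\<lambda>_. ?y"]) simp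
  then have "outer ?y \<in> K" using assms(1) by auto
  moreover have "constraint_row A b i \<bullet> ?y = 0" for i
    using assms(2) by (simp add: constraint_row_inner qp_feas_def)
  then have "Ahat A b \<bullet> outer ?y = 0"
    by (simp add: inner_Ahat outer_mult_vector inner_commute)
  ultimately show ?thesis by (simp add: rel_feas_def outer_def)
qed

lemma row0_outer_homog: "row0 (outer (homog 1 x)) = x"
  by (simp add: row0_def outer_def vec_eq_iff)

lemma Qhat_outer_homog: "Qhat Q c \<bullet> outer (homog 1 x) = qp_obj Q c x"
  by (simp add: inner_outer homog_Qhat qp_obj_def)

theorem proposition4p1:
  fixes Q :: "real^'n^'n" and c :: "real^'n" and A :: "real^'n^'m" and b :: "real^'m"
    and K :: "(real^('n::finite option)^('n option)) set"
  assumes "Q \<in> sym_mats"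
    and "qp_feas A b \<noteq> {}"
    and "\<forall>d. A *v d = 0 \<longrightarrow> 0 \<le> d \<bullet> (Q *v d)"
    and "K \<in> cone_family"
  shows "(\<forall>x \<in> qp_feas A b. rel_val_at Q c A b K x = ereal (qp_obj Q c x))
    \<and> rel_val Q c A b K = qp_val Q c A b
    \<and> (\<forall>Y. rel_optimal Q c A b K Y \<longrightarrow> qp_optimal Q c A b (row0 Y))"
proof (intro conjI ballI allI impI)
  have K: "CP \<subseteq> K" "K \<subseteq> PSD0"
    using assms(4) by (auto simp: cone_family_def)
  note lower = qp_obj_row0_le[OF assms(3) K(2)]
  note lift = outer_homog_feasible[OF K(1)]
  show "rel_val_at Q c A b K x = ereal (qp_obj Q c x)" if "x \<in> qp_feas A b" for x
    unfolding rel_val_at_def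
  proof (rule antisym)
    show "(INF Y\<in>{Y \<in> rel_feas A b K. row0 Y = x}. ereal (Qhat Q c \<bullet> Y)) \<le> ereal (qp_obj Q c x)"
      using lift[OF that]
      by (intro INF_lower2[of "outer (homog 1 x)"]) (simp_all add: row0_outer_homog Qhat_outer_homog)
  qed (auto intro!: INF_greatest lower)
  show "rel_val Q c A b K = qp_val Q c A b"
    unfolding rel_val_def qp_val_def
  proof (rule antisym)
    \<comment> \<open>The lift preserves objective values; in the other direction,
      \<open>row0\<close> maps feasible matrices to feasible points without increasing them.\<close>
    show "(INF Y\<in>rel_feas A b K. ereal (Qhat Q c \<bullet> Y))
        \<le> (INF x\<in>qp_feas A b. ereal (qp_obj Q c x))"
      by (rule INF_mono) (metis lift Qhat_outer_homog order_refl)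
    show "(INF x\<in>qp_feas A b. ereal (qp_obj Q c x))
        \<le> (INF Y\<in>rel_feas A b K. ereal (Qhat Q c \<bullet> Y))"
      by (rule INF_mono) (metis lower row0_feasible[OF K(2)] ereal_less_eq(3))
  qed
  show "qp_optimal Q c A b (row0 Y)" if "rel_optimal Q c A b K Y" for Y
  proof -
    have Y: "Y \<in> rel_feas A b K" and
      min: "\<And>Y'. Y' \<in> rel_feas A b K \<Longrightarrow> Qhat Q c \<bullet> Y \<le> Qhat Q c \<bullet> Y'"
      using that by (auto simp: rel_optimal_def is_arg_min_linorder)
    \<comment> \<open>Compare \<open>Y\<close> with the lift of the competitor
      \<open>x\<close>.\<close>
    have "qp_obj Q c (row0 Y) \<le> qp_obj Q c x" if "x \<in> qp_feas A b" for x
      using lower[OF Y, of c] min[OF lift[OF that]] by (simp add: Qhat_outer_homog)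
    then show ?thesis
      using row0_feasible[OF K(2) Y] by (simp add: qp_optimal_def is_arg_min_linorder)
  qed
qed

end
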